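(* Let $$L(x,v,p,z):=1+\sum_{n\ge 1}\ \sum_{\pi\in\mathcal{S}_n(132)}x^{\mathrm{fp}(\pi)}v^{\mathrm{exc}(\pi)}p^{\mathrm{des}(\pi)+1}z^n.$$ Then $$L(x,v,p,z)=\frac{2(1+xz(p-1))}{1+(1+v-2x)z-vz^2(p-1)^2+\sqrt{f_1(v,z)}},$$ where $$f_1(v,z)=1-2(1+v)z+\left[(1-v)^2-2v(p-1)(p+3)\right]z^2-2v(1+v)(p-1)^2 z^3+v^2(p-1)^4 z^4.$$
   Context: $\mathcal{S}_n$ is the set of permutations $\pi=\pi_1\cdots\pi_n$ of $\{1,\dots,n\}$, and $\mathcal{S}_n(132)$ is the set of those that are $132$-avoiding, i.e. for which there are no indices $i<j<k$ with $\pi_i<\pi_k<\pi_j$. For $\pi\in\mathcal{S}_n$: $\mathrm{fp}(\pi)$ is the number of fixed points ($i$ with $\pi_i=i$), $\mathrm{exc}(\pi)$ is the number of excedances ($i$ with $\pi_i>i$), and $\mathrm{des}(\pi)$ is the number of descents ($i\le n-1$ with $\pi_i>\pi_{i+1}$). The identity is one of formal power series in $z$; the square root is the power series in $z$ with constant term $1$. *)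

theory Defs
  imports
    "HOL-Computational_Algebra.Formal_Power_Series"
    "HOL-Combinatorics.Permutations"
begin

definition avoids_132 :: "nat \<Rightarrow> (nat \<Rightarrow> nat) \<Rightarrow> bool" where
  "avoids_132 n \<pi> \<longleftrightarrow>
     \<not> (\<exists>i\<in>{1..n}. \<exists>j\<in>{1..n}. \<exists>k\<in>{1..n}. i < j \<and> j < k \<and> \<pi> i < \<pi> k \<and> \<pi> k < \<pi> j)"

definition perms_132 :: "nat \<Rightarrow> (nat \<Rightarrow> nat) set" where
  "perms_132 n = {\<pi>. \<pi> permutes {1..n} \<and> avoids_132 n \<pi>}"

definition fp :: "nat \<Rightarrow> (nat \<Rightarrow> nat) \<Rightarrow> nat" where
  "fp n \<pi> = card {i \<in> {1..n}. \<pi> i = i}"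

definition exc :: "nat \<Rightarrow> (nat \<Rightarrow> nat) \<Rightarrow> nat" where
  "exc n \<pi> = card {i \<in> {1..n}. \<pi> i > i}"

definition des :: "nat \<Rightarrow> (nat \<Rightarrow> nat) \<Rightarrow> nat" where
  "des n \<pi> = card {i \<in> {1..<n}. \<pi> i > \<pi> (i + 1)}"

text \<open>
  The variable \<open>z\<close> is \<^const>\<open>fps_X\<close>. The marking variables \<open>x\<close>, \<open>v\<close>, \<open>p\<close> are arbitrary elements
  of a field of characteristic 0; indeterminates are covered by taking that field to be a field
  of rational functions in \<open>x\<close>, \<open>v\<close>, \<open>p\<close>.
\<close>

definition L :: "'a::field_char_0 \<Rightarrow> 'a \<Rightarrow> 'a \<Rightarrow> 'a fps" where
  "L x v p = 1 + Abs_fps (\<lambda>n. if n \<ge> 1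
     then \<Sum>\<pi>\<in>perms_132 n. x ^ fp n \<pi> * v ^ exc n \<pi> * p ^ (des n \<pi> + 1) else 0)"

definition f\<^sub>1 :: "'a::field_char_0 \<Rightarrow> 'a \<Rightarrow> 'a fps" where
  "f\<^sub>1 v p = 1 - fps_const (2 * (1 + v)) * fps_X
     + fps_const ((1 - v)^2 - 2 * v * (p - 1) * (p + 3)) * fps_X^2
     - fps_const (2 * v * (1 + v) * (p - 1)^2) * fps_X^3
     + fps_const (v^2 * (p - 1)^4) * fps_X^4"

text \<open>
  The first argument of \<^const>\<open>fps_radical\<close> selects the constant term of the root. It is 1 here,
  so the definition is meant only for series with constant term 1.
\<close>

definition fps_sqrt1 :: "'a::field_char_0 fps \<Rightarrow> 'a fps" where
  "fps_sqrt1 f = fps_radical (\<lambda>_ _. 1) 2 f"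

lemma fps_sqrt1_unique:
  assumes "fps_nth f 0 = 1"
  shows "s = fps_sqrt1 f \<longleftrightarrow> s ^ 2 = f \<and> fps_nth s 0 = 1"
proof -
  have *: "s ^ 2 = f \<longleftrightarrow> s = fps_sqrt1 f" if "fps_nth s 0 = 1"
    using radical_unique[of "\<lambda>_ _. 1" 1 f s] assms that
    by (simp add: fps_sqrt1_def numeral_2_eq_2)
  moreover have "fps_nth (fps_sqrt1 f) 0 = 1"
    by (simp add: fps_sqrt1_def)
  ultimately show ?thesis by blast
qed

lemma fps_nth_f\<^sub>1_0: "fps_nth (f\<^sub>1 v p) 0 = 1"
  by (simp add: f\<^sub>1_def)

end

theory Submission
  imports Defs "HOL-Computational_Algebra.Formal_Laurent_Series"
begin

text \<open>
  A nonempty \<open>132\<close>-avoiding permutation \<open>\<pi>\<close> has the form \<open>\<sigma>' n \<tau>\<close>, where \<open>\<tau>\<close> is a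
  \<open>132\<close>-avoiding permutation of \<open>1, \<dots>, m\<close> and \<open>\<sigma>'\<close> is a \<open>132\<close>-avoiding permutation \<open>\<sigma>\<close> raised by \<open>m\<close>. Fixed
  points and excedances of \<open>\<pi>\<close> are not those of \<open>\<sigma>\<close> and \<open>\<tau>\<close>, because values of \<open>\<sigma>\<close> and positions
  of \<open>\<tau>\<close> are moved. Hence the diagonal is moved too: \<open>shifted_sum x v p s n\<close> compares
  \<open>\<pi> i + s\<close> with \<open>i\<close>, for any integer \<open>s\<close>, and the decomposition becomes a recursion in \<open>s\<close> and \<open>n\<close>
  (\<open>shifted_sum_Suc\<close>).

  When \<open>\<bar>s\<bar> \<ge> n\<close>, the moved diagonal misses the permutation and only descents matter. For
  \<open>\<bar>s\<bar> \<le> n\<close> at least one of the two factors in each term of the recursion is of this kind, so the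
  recursion is linear. In terms of
  \<open>H = (\<Sum>n. z ^ n * (\<Sum>s | \<bar>s\<bar> \<le> n. shifted_sum x v p s n * t ^ s))\<close> it reads
  \<open>U * W * H = 1 + x * q * z + z * \<Omega> H\<close> with \<open>q = p - 1\<close> (\<open>kernel_equation\<close>). Here \<open>\<Omega>\<close> multiplies
  the positive powers of \<open>t\<close> by \<open>v\<close>, the constant term by \<open>x\<close> and the negative powers by \<open>1\<close>, and
  \<open>U = M (v * z * t)\<close>, \<open>W = M (z / t)\<close>, where \<open>M\<close> is the reciprocal of the generating function of
  the descent statistic.

  This is an equation of Wiener-Hopf type: its solution has to be split into the parts with positive,
  zero and negative powers of \<open>t\<close>. It is solvable because \<open>U\<close> and \<open>W\<close>, which involve \<open>t\<close>
  and \<open>1 / t\<close> respectively, satisfy the biquadratic relation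
  \<open>v * z\<^sup>2 * (1 + q * U) * (1 + q * W) = U * W * (1 - U) * (1 - W)\<close> with coefficients free of \<open>t\<close>
  (\<open>twisted_curve\<close>). The solution is
  \<open>H = (1 + x * q * z) / (R - x * z) * (1 + (1 - U) / (U - u) + (1 - W) / (W - w))\<close>
  with \<open>u\<close>, \<open>w\<close>, \<open>R\<close> free of \<open>t\<close>: after clearing denominators the kernel equation becomes the
  biquadratic relation itself when coefficients agree, and this determines \<open>u\<close> and \<open>w\<close> in terms of \<open>R\<close>,
  and a quadratic equation for \<open>R\<close> (\<open>kernel_identity\<close>, \<open>pole_relations\<close>). The second summand has
  only positive and the third only negative powers of \<open>t\<close>, so the coefficient of \<open>t ^ 0\<close>, which is
  \<open>L\<close>, equals \<open>(1 + x * q * z) / (R - x * z)\<close> (\<open>diagonal_series\<close>). The square root in the theorem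
  comes from solving the quadratic equation for \<open>R\<close>.
\<close>

unbundle Formal_Power_Series.fps_syntax
unbundle Formal_Laurent_Series.fps_syntax

section \<open>Decomposition of 132-avoiding permutations at the maximum\<close>

lemma permutes_interval_if_inj:
  assumes "inj_on f {1..n}" "\<And>i. i \<in> {1..n} \<Longrightarrow> f i \<in> {1..n::nat}" "\<And>i. i \<notin> {1..n} \<Longrightarrow> f i = i"
  shows "f permutes {1..n}"
proof (rule bij_imp_permutes)
  have "f ` {1..n} = {1..n}"
    by (rule endo_inj_surj) (use assms in auto)
  with assms(1) show "bij_betw f {1..n} {1..n}" by (simp add: bij_betw_def)
qed (use assms(3) in auto)

text \<open>
  The permutation \<open>\<sigma>' n \<tau>\<close> with \<open>n = j + m + 1\<close>, for \<open>\<sigma>\<close> of size \<open>j\<close> and \<open>\<tau>\<close> of size \<open>m\<close>. It is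
  the identity outside \<open>{1..n}\<close>, as permutations of \<open>{1..n}\<close> are.
\<close>

definition glue :: "nat \<Rightarrow> nat \<Rightarrow> (nat \<Rightarrow> nat) \<Rightarrow> (nat \<Rightarrow> nat) \<Rightarrow> nat \<Rightarrow> nat" where
  "glue j m \<sigma> \<tau> i =
     (if i \<in> {1..j} then \<sigma> i + m
      else if i = j + 1 then j + m + 1
      else if i \<in> {j+2..j+m+1} then \<tau> (i - (j + 1))
      else i)"

lemma glue_left: "i \<in> {1..j} \<Longrightarrow> glue j m \<sigma> \<tau> i = \<sigma> i + m"
  and glue_max: "glue j m \<sigma> \<tau> (j + 1) = j + m + 1"
  and glue_right: "i \<in> {1..m} \<Longrightarrow> glue j m \<sigma> \<tau> (i + (j + 1)) = \<tau> i"
  and glue_outside: "i \<notin> {1..j+m+1} \<Longrightarrow> glue j m \<sigma> \<tau> i = i"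
  by (auto simp: glue_def)

lemma position_cases:
  assumes "i \<in> {1..j+m+1::nat}"
  obtains (left) "i \<in> {1..j}" | (max) "i = j + 1" | (right) i' where "i = i' + (j + 1)" "i' \<in> {1..m}"
proof -
  consider "i \<le> j" | "i = j + 1" | "i > j + 1" by linarith
  then show thesis
  proof cases
    case 3
    then have "i = (i - (j+1)) + (j + 1)" "i - (j+1) \<in> {1..m}" using assms by auto
    then show thesis by (rule right)
  qed (use assms left max in auto)
qed

lemma perms_132D:
  assumes "\<pi> \<in> perms_132 n"
  shows "\<pi> permutes {1..n}"
    and "i \<in> {1..n} \<Longrightarrow> \<pi> i \<in> {1..n}"
    and "i \<notin> {1..n} \<Longrightarrow> \<pi> i = i"
    and "\<pi> i = \<pi> k \<longleftrightarrow> i = k"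
    and "\<lbrakk>i \<in> {1..n}; j \<in> {1..n}; k \<in> {1..n}; i < j; j < k; \<pi> i < \<pi> k\<rbrakk> \<Longrightarrow> \<pi> j \<le> \<pi> k"
proof -
  show *: "\<pi> permutes {1..n}" using assms by (simp add: perms_132_def)
  show "i \<in> {1..n} \<Longrightarrow> \<pi> i \<in> {1..n}" using permutes_in_image[OF *] by blast
  show "i \<notin> {1..n} \<Longrightarrow> \<pi> i = i" using permutes_not_in[OF *] by blast
  show "\<pi> i = \<pi> k \<longleftrightarrow> i = k" using permutes_inj[OF *] by (simp add: inj_eq)
  show "\<pi> j \<le> \<pi> k" if "i \<in> {1..n}" "j \<in> {1..n}" "k \<in> {1..n}" "i < j" "j < k" "\<pi> i < \<pi> k"
  proof -
    have "avoids_132 n \<pi>" using assms by (simp add: perms_132_def)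
    with that show ?thesis unfolding avoids_132_def by (meson not_less)
  qed
qed

lemma perms_132I:
  assumes "inj_on \<pi> {1..n}" "\<And>i. i \<in> {1..n} \<Longrightarrow> \<pi> i \<in> {1..n}" "\<And>i. i \<notin> {1..n} \<Longrightarrow> \<pi> i = i"
    and "\<And>i j k. \<lbrakk>i \<in> {1..n}; j \<in> {1..n}; k \<in> {1..n}; i < j; j < k; \<pi> i < \<pi> k\<rbrakk> \<Longrightarrow> \<pi> j \<le> \<pi> k"
  shows "\<pi> \<in> perms_132 n"
proof -
  have "avoids_132 n \<pi>" unfolding avoids_132_def using assms(4) by (meson not_less)
  with permutes_interval_if_inj[of \<pi> n, OF assms(1-3)] show ?thesis by (simp add: perms_132_def)
qed

text \<open>
  The last entry of a forbidden pattern is neither its largest nor its smallest one. So it is not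
  the maximum \<open>n\<close>, and if it stands right of the maximum then so does the first entry, since every
  value right of the maximum is at most \<open>m\<close> and every other value is larger. Hence the pattern lies
  in \<open>\<sigma>\<close> or in \<open>\<tau>\<close>.
\<close>

lemma glue_in_perms_132:
  assumes s: "\<sigma> \<in> perms_132 j" and t: "\<tau> \<in> perms_132 m"
  shows "glue j m \<sigma> \<tau> \<in> perms_132 (j + m + 1)"
proof (rule perms_132I)
  note S = perms_132D[OF s] and T = perms_132D[OF t]
  show "inj_on (glue j m \<sigma> \<tau>) {1..j + m + 1}"
  proof (rule inj_onI)
    fix a b assume a: "a \<in> {1..j+m+1}" and b: "b \<in> {1..j+m+1}"
      and eq: "glue j m \<sigma> \<tau> a = glue j m \<sigma> \<tau> b"
    note simps = glue_left glue_max[simplified] glue_right[simplified]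
    show "a = b"
      using a
    proof (cases rule: position_cases)
      case left
      then have "\<sigma> a \<in> {1..j}" using S(2) by blast
      show ?thesis using b
      proof (cases rule: position_cases)
        case left
        then show ?thesis using eq \<open>a \<in> {1..j}\<close> S(4)[of a b] by (simp add: simps)
      next
        case max
        then show ?thesis using eq \<open>a \<in> {1..j}\<close> \<open>\<sigma> a \<in> {1..j}\<close> by (simp add: simps)
      next
        case (right b')
        then show ?thesis using eq \<open>a \<in> {1..j}\<close> \<open>\<sigma> a \<in> {1..j}\<close> T(2)[of b'] by (simp add: simps)
      qed
    next
      case max
      show ?thesis using b
      proof (cases rule: position_cases)
        case left
        then show ?thesis using eq \<open>a = j + 1\<close> S(2)[of b] by (simp add: simps)
      next
        case max
        then show ?thesis using \<open>a = j + 1\<close> by simp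
      next
        case (right b')
        then show ?thesis using eq \<open>a = j + 1\<close> T(2)[of b'] by (simp add: simps)
      qed
    next
      case (right a')
      then have "\<tau> a' \<in> {1..m}" using T(2) by blast
      show ?thesis using b
      proof (cases rule: position_cases)
        case left
        then show ?thesis using eq right \<open>\<tau> a' \<in> {1..m}\<close> S(2)[of b] by (simp add: simps)
      next
        case max
        then show ?thesis using eq right \<open>\<tau> a' \<in> {1..m}\<close> by (simp add: simps)
      next
        case (right b')
        then show ?thesis using eq \<open>a = a' + (j + 1)\<close> \<open>a' \<in> {1..m}\<close> T(4)[of a' b'] by (simp add: simps)
      qed
    qed
  qed
  show "glue j m \<sigma> \<tau> i \<in> {1..j+m+1}" if "i \<in> {1..j+m+1}" for i
    using that
    by (cases rule: position_cases)
       (use S(2)[of i] T(2)[of "i - (j+1)"] in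
         \<open>auto simp: glue_left glue_max[simplified] glue_right[simplified]\<close>)
  show "glue j m \<sigma> \<tau> i = i" if "i \<notin> {1..j+m+1}" for i
    using that by (rule glue_outside)
  show "glue j m \<sigma> \<tau> b \<le> glue j m \<sigma> \<tau> c"
    if a: "a \<in> {1..j+m+1}" and b: "b \<in> {1..j+m+1}" and c: "c \<in> {1..j+m+1}"
      and ab: "a < b" and bc: "b < c" and less: "glue j m \<sigma> \<tau> a < glue j m \<sigma> \<tau> c" for a b c
    using c
  proof (cases rule: position_cases)
    case left
    then have "a \<in> {1..j}" "b \<in> {1..j}" using a b ab bc by auto
    with left show ?thesis using S(5)[of a b c] ab bc less by (simp add: glue_left)
  next
    case max
    then have "b \<in> {1..j}" using b bc by auto
    with max show ?thesis using S(2)[of b] by (simp add: glue_left glue_max[simplified])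
  next
    case (right c')
    have small: "glue j m \<sigma> \<tau> c \<le> m" using right T(2)[of c'] by (simp add: glue_right[simplified])
    have "\<not> a \<le> j + 1"
      using less small a by (auto simp: glue_def split: if_splits)
    then have "a = (a - (j+1)) + (j+1)" "a - (j+1) \<in> {1..m}" "b = (b - (j+1)) + (j+1)" "b - (j+1) \<in> {1..m}"
      using a b ab by auto
    then obtain a' b' where "a = a' + (j+1)" "a' \<in> {1..m}" "b = b' + (j+1)" "b' \<in> {1..m}" by blast
    with right show ?thesis using T(5)[of a' b' c'] ab bc less by (simp add: glue_right[simplified])
  qed
qed

text \<open>
  The position of the maximum recovers \<open>j\<close>.
\<close>

lemma glue_inject:
  assumes "\<sigma> \<in> perms_132 j" "\<tau> \<in> perms_132 (N - j)" "\<sigma>' \<in> perms_132 j'" "\<tau>' \<in> perms_132 (N - j')"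
    and "j \<le> N" "j' \<le> N" and eq: "glue j (N - j) \<sigma> \<tau> = glue j' (N - j') \<sigma>' \<tau>'"
  shows "j = j' \<and> \<sigma> = \<sigma>' \<and> \<tau> = \<tau>'"
proof -
  have "glue j (N - j) \<sigma> \<tau> \<in> perms_132 (j + (N - j) + 1)"
    using assms by (intro glue_in_perms_132)
  moreover have "glue j (N - j) \<sigma> \<tau> (j + 1) = glue j (N - j) \<sigma> \<tau> (j' + 1)"
    using glue_max[of j "N - j" \<sigma> \<tau>] glue_max[of j' "N - j'" \<sigma>' \<tau>'] assms(5,6) eq by simp
  ultimately have j: "j' = j" using perms_132D(4) by fastforce
  have "\<sigma> i = \<sigma>' i" for i
    using perms_132D(3)[OF assms(1), of i] perms_132D(3)[OF assms(3), of i]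
      glue_left[of i j "N - j" \<sigma> \<tau>] glue_left[of i j "N - j" \<sigma>' \<tau>'] eq j
    by (cases "i \<in> {1..j}") auto
  moreover have "\<tau> i = \<tau>' i" for i
    using perms_132D(3)[OF assms(2), of i] perms_132D(3)[OF assms(4), of i]
      glue_right[of i "N - j" j \<sigma> \<tau>] glue_right[of i "N - j" j \<sigma>' \<tau>'] eq j
    by (cases "i \<in> {1..N-j}") auto
  ultimately show ?thesis using j by auto
qed

text \<open>
  An entry left of the maximum that is smaller than an entry right of it would form the pattern
  \<open>132\<close> with the maximum. So the values right of the maximum form an initial segment of the
  positive integers, which is \<open>{1..m}\<close> by counting.
\<close>

lemma perms_132_Suc_is_glue:
  assumes pi: "\<pi> \<in> perms_132 (Suc N)"
  obtains j \<sigma> \<tau> where "j \<le> N" "\<sigma> \<in> perms_132 j" "\<tau> \<in> perms_132 (N - j)" "\<pi> = glue j (N - j) \<sigma> \<tau>"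
proof -
  note P = perms_132D[OF pi]
  have "\<pi> ` {1..Suc N} = {1..Suc N}" using P(1) by (rule permutes_image)
  then obtain k where k: "k \<in> {1..Suc N}" "\<pi> k = Suc N" by (metis imageE atLeastAtMost_iff le_refl Suc_le_mono le0 One_nat_def)
  define j where "j = k - 1"
  define m where "m = N - j"
  have j: "j \<le> N" "\<pi> (j + 1) = Suc N" "N = j + m" using k by (auto simp: j_def m_def)
  define A where "A = \<pi> ` {j+2..Suc N}"
  have cardA: "card A = m"
    using P(4) j by (simp add: A_def card_image inj_on_def)
  have less_Suc: "\<pi> i \<le> N" if "i \<in> {1..Suc N}" "i \<noteq> j + 1" for i
    using P(2)[OF that(1)] P(4)[of i "j+1"] j that by (auto simp: le_Suc_eq)
  \<comment> \<open>This is where avoidance of \<open>132\<close> enters.\<close>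
  have sep: "\<pi> c < \<pi> a" if "a \<in> {1..j}" "c \<in> {j+2..Suc N}" for a c
    using P(5)[of a "j+1" c] P(4)[of a c] less_Suc[of c] that j by (cases "\<pi> a" "\<pi> c" rule: linorder_cases) auto
  have right: "\<pi> c \<in> {1..m}" if c: "c \<in> {j+2..Suc N}" for c
  proof -
    have "{1..\<pi> c} \<subseteq> A"
    proof
      fix y assume y: "y \<in> {1..\<pi> c}"
      then have "y \<in> {1..Suc N}" using P(2)[of c] c by auto
      then obtain i where i: "i \<in> {1..Suc N}" "y = \<pi> i" using \<open>\<pi> ` {1..Suc N} = {1..Suc N}\<close> by (metis imageE)
      have "i \<notin> {1..j}" using sep[of i c] c y i by auto
      moreover have "i \<noteq> j + 1" using less_Suc[of c] c y i j by auto
      ultimately have "i \<in> {j+2..Suc N}" using i by auto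
      then show "y \<in> A" using i by (simp add: A_def)
    qed
    from card_mono[OF _ this] have "\<pi> c \<le> m" using cardA by (simp add: A_def)
    then show ?thesis using P(2)[of c] c by auto
  qed
  have left: "\<pi> a \<in> {m+1..N}" if a: "a \<in> {1..j}" for a
  proof -
    have "A \<subseteq> {1..<\<pi> a}" using sep[OF a] right by (auto simp: A_def)
    from card_mono[OF _ this] have "m \<le> \<pi> a - 1" using cardA by simp
    moreover have "\<pi> a \<ge> 1" using P(2)[of a] a j by auto
    ultimately show ?thesis using less_Suc[of a] a j by auto
  qed
  define \<sigma> where "\<sigma> i = (if i \<in> {1..j} then \<pi> i - m else i)" for i
  define \<tau> where "\<tau> i = (if i \<in> {1..m} then \<pi> (i + (j + 1)) else i)" for i
  have sig: "\<pi> i = \<sigma> i + m" if "i \<in> {1..j}" for i using left[OF that] that by (simp add: \<sigma>_def)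
  have "\<sigma> \<in> perms_132 j"
  proof (rule perms_132I)
    show "inj_on \<sigma> {1..j}"
      using P(4) sig by (metis inj_onI)
    show "\<sigma> i \<in> {1..j}" if "i \<in> {1..j}" for i using left[OF that] sig[OF that] j by auto
    show "\<sigma> b \<le> \<sigma> c" if "a \<in> {1..j}" "b \<in> {1..j}" "c \<in> {1..j}" "a < b" "b < c" "\<sigma> a < \<sigma> c" for a b c
      using P(5)[of a b c] that sig[of a] sig[of b] sig[of c] j by simp
  qed (auto simp: \<sigma>_def)
  moreover have "\<tau> \<in> perms_132 m"
  proof (rule perms_132I)
    show "inj_on \<tau> {1..m}" using P(4) by (simp add: inj_on_def \<tau>_def)
    show "\<tau> i \<in> {1..m}" if "i \<in> {1..m}" for i using right[of "i + (j+1)"] that j by (simp add: \<tau>_def)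
    show "\<tau> b \<le> \<tau> c" if "a \<in> {1..m}" "b \<in> {1..m}" "c \<in> {1..m}" "a < b" "b < c" "\<tau> a < \<tau> c" for a b c
      using P(5)[of "a + (j+1)" "b + (j+1)" "c + (j+1)"] that j by (simp add: \<tau>_def)
  qed (auto simp: \<tau>_def)
  moreover have "\<pi> = glue j m \<sigma> \<tau>"
  proof
    fix i show "\<pi> i = glue j m \<sigma> \<tau> i"
    proof (cases "i \<in> {1..j+m+1}")
      case True
      then show ?thesis
        by (cases rule: position_cases) (use j in \<open>auto simp: sig glue_left glue_max[simplified] glue_right[simplified] \<tau>_def\<close>)
    next
      case False
      then show ?thesis using P(3)[of i] glue_outside[OF False] j by simp
    qed
  qed
  ultimately show thesis using that[OF j(1)] by (simp only: m_def)
qed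

lemma bij_betw_glue:
  "bij_betw (\<lambda>(j, \<sigma>, \<tau>). glue j (N - j) \<sigma> \<tau>)
     (SIGMA j:{..N}. perms_132 j \<times> perms_132 (N - j)) (perms_132 (Suc N))"
  (is "bij_betw ?f ?S ?P")
proof (rule bij_betwI')
  fix a b assume ab: "a \<in> ?S" "b \<in> ?S"
  obtain j \<sigma> \<tau> j' \<sigma>' \<tau>' where [simp]: "a = (j, \<sigma>, \<tau>)" "b = (j', \<sigma>', \<tau>')"
    by (metis prod.collapse)
  show "?f a = ?f b \<longleftrightarrow> a = b"
  proof
    assume "?f a = ?f b"
    then show "a = b" using ab glue_inject[of \<sigma> j \<tau> N \<sigma>' j' \<tau>'] by simp
  qed simp
next
  fix a assume "a \<in> ?S"
  then obtain j \<sigma> \<tau> where "a = (j, \<sigma>, \<tau>)" "j \<le> N" "\<sigma> \<in> perms_132 j" "\<tau> \<in> perms_132 (N - j)"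
    by blast
  then show "?f a \<in> ?P" using glue_in_perms_132[of \<sigma> j \<tau> "N - j"] by simp
next
  fix b assume "b \<in> ?P"
  then obtain j \<sigma> \<tau> where "j \<le> N" "\<sigma> \<in> perms_132 j" "\<tau> \<in> perms_132 (N - j)" "b = glue j (N - j) \<sigma> \<tau>"
    by (rule perms_132_Suc_is_glue)
  then show "\<exists>a\<in>?S. b = ?f a" by (intro bexI[of _ "(j, \<sigma>, \<tau>)"]) simp_all
qed

lemma finite_perms_132: "finite (perms_132 n)"
  by (rule finite_subset[OF _ finite_permutations[of "{1..n}"]]) (auto simp: perms_132_def)

lemma perms_132_0: "perms_132 0 = {id}"
  by (auto simp: perms_132_def avoids_132_def)

section \<open>Weights relative to a shifted diagonal\<close>

text \<open>
  The weight of an entry at signed height \<open>d\<close> above the diagonal.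
\<close>

definition mark :: "'a \<Rightarrow> 'a \<Rightarrow> int \<Rightarrow> 'a::comm_ring_1" where
  "mark x v d = (if d = 0 then x else if d > 0 then v else 1)"

definition diagonal_weight :: "'a::comm_ring_1 \<Rightarrow> 'a \<Rightarrow> int \<Rightarrow> nat \<Rightarrow> (nat \<Rightarrow> nat) \<Rightarrow> 'a" where
  "diagonal_weight x v s n \<pi> = (\<Prod>i\<in>{1..n}. mark x v (int (\<pi> i) - int i + s))"

definition run_weight :: "'a::comm_ring_1 \<Rightarrow> nat \<Rightarrow> (nat \<Rightarrow> nat) \<Rightarrow> 'a" where
  "run_weight p n \<pi> = (if n = 0 then 1 else p ^ (des n \<pi> + 1))"

definition shifted_sum :: "'a::comm_ring_1 \<Rightarrow> 'a \<Rightarrow> 'a \<Rightarrow> int \<Rightarrow> nat \<Rightarrow> 'a" where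
  "shifted_sum x v p s n = (\<Sum>\<pi>\<in>perms_132 n. diagonal_weight x v s n \<pi> * run_weight p n \<pi>)"

lemma diagonal_weight_0: "diagonal_weight x v 0 n \<pi> = x ^ fp n \<pi> * v ^ exc n \<pi>"
proof -
  have "diagonal_weight x v 0 n \<pi> =
      (\<Prod>i\<in>{1..n}. (if \<pi> i = i then x else 1) * (if \<pi> i > i then v else 1))"
    unfolding diagonal_weight_def by (intro prod.cong) (auto simp: mark_def)
  also have "\<dots> = x ^ fp n \<pi> * v ^ exc n \<pi>"
    unfolding fp_def exc_def prod.distrib
    by (simp only: prod.If_cases[OF finite_atLeastAtMost] prod_constant) (simp add: Int_def)
  finally show ?thesis .
qed

text \<open>
  Entries of \<open>\<sigma>\<close> are raised by \<open>m\<close>, and entries of \<open>\<tau>\<close> stand \<open>j + 1\<close> places further right,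
  which changes the shift for the two parts by \<open>m\<close> and \<open>- (j + 1)\<close>.
\<close>

lemma diagonal_weight_glue:
  "diagonal_weight x v s (j + m + 1) (glue j m \<sigma> \<tau>) =
     mark x v (int m + s) * diagonal_weight x v (s + int m) j \<sigma> * diagonal_weight x v (s - int j - 1) m \<tau>"
proof -
  let ?g = "\<lambda>i. mark x v (int (glue j m \<sigma> \<tau> i) - int i + s)"
  have "prod ?g {1..(j + 1) + m} = prod ?g {1..j + 1} * prod ?g {(j + 1) + 1..(j + 1) + m}"
    by (rule prod.ub_add_nat) simp
  also have "prod ?g {1..j + 1} = prod ?g {1..j} * ?g (j + 1)" by simp
  also have "prod ?g {1..j} = diagonal_weight x v (s + int m) j \<sigma>"
    unfolding diagonal_weight_def
    by (intro prod.cong refl arg_cong[where f = "mark x v"]) (simp add: glue_left)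
  also have "prod ?g {(j + 1) + 1..(j + 1) + m} = (\<Prod>i\<in>{1..m}. ?g (i + (j + 1)))"
    using prod.shift_bounds_cl_nat_ivl[of ?g 1 "j+1" m] by (simp add: add_ac)
  also have "\<dots> = diagonal_weight x v (s - int j - 1) m \<tau>"
    unfolding diagonal_weight_def
    by (intro prod.cong refl arg_cong[where f = "mark x v"]) (subst glue_right, auto)
  also have "?g (j + 1) = mark x v (int m + s)"
    using glue_max[of j m \<sigma> \<tau>] by simp
  finally show ?thesis by (simp add: diagonal_weight_def mult_ac add_ac)
qed

lemma des_glue:
  assumes s: "\<sigma> \<in> perms_132 j" and t: "\<tau> \<in> perms_132 m"
  shows "des (j + m + 1) (glue j m \<sigma> \<tau>) = des j \<sigma> + (if m = 0 then 0 else des m \<tau> + 1)"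
proof -
  let ?g = "glue j m \<sigma> \<tau>"
  let ?D = "{i \<in> {1..<j+m+1}. ?g i > ?g (i + 1)}"
  let ?A = "{i \<in> {1..<j}. \<sigma> i > \<sigma> (i + 1)}" and ?B = "{i \<in> {1..<m}. \<tau> i > \<tau> (i + 1)}"
  let ?M = "if m = 0 then {} else {j + 1}"
  have r: "?g (i + (j + 1)) > ?g (i + (j + 1) + 1) \<longleftrightarrow> \<tau> i > \<tau> (i + 1)" if "i \<in> {1..<m}" for i
    using glue_right[of i m j \<sigma> \<tau>] glue_right[of "i + 1" m j \<sigma> \<tau>] that by (simp add: add_ac)
  have "i \<in> ?D \<longleftrightarrow> i \<in> ?A \<union> ?M \<union> (\<lambda>i. i + (j + 1)) ` ?B" for i
  proof (cases "i \<in> {1..<j+m+1}")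
    case True
    then have "i \<in> {1..j+m+1}" by simp
    then show ?thesis
    proof (cases rule: position_cases)
      case left
      show ?thesis
      proof (cases "i = j")
        case True
        then show ?thesis using left glue_max[of j m \<sigma> \<tau>] perms_132D(2)[OF s, of j] by (auto simp: glue_left)
      next
        case False
        then show ?thesis using left by (auto simp: glue_left)
      qed
    next
      case max
      then have "m > 0" using True by simp
      then have "?g (1 + (j + 1)) = \<tau> 1" "\<tau> 1 \<in> {1..m}"
        using glue_right[of 1 m j \<sigma> \<tau>] perms_132D(2)[OF t, of 1] by auto
      then show ?thesis using max \<open>m > 0\<close> glue_max[of j m \<sigma> \<tau>] by auto
    next
      case (right i')
      then have "i' \<in> {1..<m}" using True by auto
      then show ?thesis using right r[of i'] True by auto
    qed
  qed (auto split: if_splits)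
  then have "?D = ?A \<union> ?M \<union> (\<lambda>i. i + (j + 1)) ` ?B" by blast
  moreover have "card \<dots> = card ?A + card ?M + card ?B"
    by (subst card_Un_disjoint; (subst card_Un_disjoint)?) (auto simp: card_image inj_on_def split: if_splits)
  ultimately show ?thesis by (simp add: des_def)
qed

text \<open>
  The maximum is the top of a descent exactly when \<open>\<tau>\<close> is nonempty, and it is never the bottom
  of one. So it contributes a factor \<open>p\<close> of its own only when \<open>\<sigma>\<close> is empty.
\<close>

lemma run_weight_glue:
  assumes "\<sigma> \<in> perms_132 j" "\<tau> \<in> perms_132 m"
  shows "run_weight p (j + m + 1) (glue j m \<sigma> \<tau>) =
    (if j = 0 then p else run_weight p j \<sigma>) * run_weight p m \<tau>"
  using des_glue[OF assms] by (simp add: run_weight_def des_def power_add)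

lemma shifted_sum_0: "shifted_sum x v p s 0 = 1"
  by (simp add: shifted_sum_def perms_132_0 diagonal_weight_def run_weight_def)

text \<open>
  The correction \<open>p - 1\<close> for \<open>j = 0\<close> turns the weight \<open>1\<close> of the empty \<open>\<sigma>\<close> into \<open>p\<close>.
\<close>

lemma shifted_sum_Suc:
  "shifted_sum x v p s (Suc N) =
     (\<Sum>j\<le>N. mark x v (int (N - j) + s)
        * (shifted_sum x v p (s + int (N - j)) j + (if j = 0 then p - 1 else 0))
        * shifted_sum x v p (s - int j - 1) (N - j))"
proof -
  let ?w = "\<lambda>s n \<pi>. diagonal_weight x v s n \<pi> * run_weight p n \<pi>"
  let ?S = "SIGMA j:{..N}. perms_132 j \<times> perms_132 (N - j)"
  let ?c = "\<lambda>j \<sigma>. diagonal_weight x v (s + int (N - j)) j \<sigma> * (if j = 0 then p else run_weight p j \<sigma>)"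
  have "shifted_sum x v p s (Suc N) = (\<Sum>(j, \<sigma>, \<tau>)\<in>?S. ?w s (Suc N) (glue j (N - j) \<sigma> \<tau>))"
    unfolding shifted_sum_def
    by (subst sum.reindex_bij_betw[OF bij_betw_glue, symmetric]) (simp add: case_prod_unfold)
  also have "\<dots> = (\<Sum>j\<le>N. \<Sum>(\<sigma>, \<tau>)\<in>perms_132 j \<times> perms_132 (N - j). ?w s (Suc N) (glue j (N - j) \<sigma> \<tau>))"
    by (subst sum.Sigma) (auto simp: finite_perms_132)
  also have "\<dots> = (\<Sum>j\<le>N. mark x v (int (N - j) + s)
        * ((\<Sum>\<sigma>\<in>perms_132 j. ?c j \<sigma>) * shifted_sum x v p (s - int j - 1) (N - j)))"
  proof (rule sum.cong[OF refl])
    fix j assume j: "j \<in> {..N}"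
    have "(\<Sum>(\<sigma>, \<tau>)\<in>perms_132 j \<times> perms_132 (N - j). ?w s (Suc N) (glue j (N - j) \<sigma> \<tau>))
      = (\<Sum>(\<sigma>, \<tau>)\<in>perms_132 j \<times> perms_132 (N - j).
          mark x v (int (N - j) + s) * (?c j \<sigma> * ?w (s - int j - 1) (N - j) \<tau>))"
    proof (rule sum.cong[OF refl], clarify)
      fix \<sigma> \<tau> assume st: "\<sigma> \<in> perms_132 j" "\<tau> \<in> perms_132 (N - j)"
      show "?w s (Suc N) (glue j (N - j) \<sigma> \<tau>) =
          mark x v (int (N - j) + s) * (?c j \<sigma> * ?w (s - int j - 1) (N - j) \<tau>)"
        using run_weight_glue[OF st, of p] diagonal_weight_glue[of x v s j "N - j" \<sigma> \<tau>] j
        by (simp add: mult_ac)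
    qed
    also have "\<dots> = mark x v (int (N - j) + s) *
        ((\<Sum>\<sigma>\<in>perms_132 j. ?c j \<sigma>) * shifted_sum x v p (s - int j - 1) (N - j))"
      unfolding shifted_sum_def sum_product
      by (simp add: sum_distrib_left sum.cartesian_product case_prod_unfold)
    finally show "(\<Sum>(\<sigma>, \<tau>)\<in>perms_132 j \<times> perms_132 (N - j). ?w s (Suc N) (glue j (N - j) \<sigma> \<tau>)) = \<dots>" .
  qed
  also have "\<dots> = (\<Sum>j\<le>N. mark x v (int (N - j) + s)
        * ((shifted_sum x v p (s + int (N - j)) j + (if j = 0 then p - 1 else 0))
        * shifted_sum x v p (s - int j - 1) (N - j)))"
  proof (rule sum.cong[OF refl])
    fix j
    have "(\<Sum>\<sigma>\<in>perms_132 j. ?c j \<sigma>) = shifted_sum x v p (s + int (N - j)) j + (if j = 0 then p - 1 else 0)"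
      by (cases "j = 0")
         (simp_all add: shifted_sum_0 perms_132_0 diagonal_weight_def, simp add: shifted_sum_def diagonal_weight_def)
    then show "mark x v (int (N - j) + s)
        * ((\<Sum>\<sigma>\<in>perms_132 j. ?c j \<sigma>) * shifted_sum x v p (s - int j - 1) (N - j))
      = mark x v (int (N - j) + s)
        * ((shifted_sum x v p (s + int (N - j)) j + (if j = 0 then p - 1 else 0))
        * shifted_sum x v p (s - int j - 1) (N - j))" by simp
  qed
  finally show ?thesis by (simp only: mult.assoc)
qed

text \<open>
  The common value of all shifted sums, up to a power of \<open>v\<close>, once the diagonal has been moved
  past the permutation; these are the Narayana polynomials in \<open>p\<close>.
\<close>

definition descent_sum :: "'a::comm_ring_1 \<Rightarrow> nat \<Rightarrow> 'a" where
  "descent_sum p n = (\<Sum>\<pi>\<in>perms_132 n. run_weight p n \<pi>)"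

lemma shifted_sum_below:
  assumes "s \<le> - int n"
  shows "shifted_sum x v p s n = descent_sum p n"
proof -
  have "diagonal_weight x v s n \<pi> = 1" if "\<pi> \<in> perms_132 n" for \<pi>
    unfolding diagonal_weight_def
  proof (intro prod.neutral ballI)
    fix i assume "i \<in> {1..n}"
    then show "mark x v (int (\<pi> i) - int i + s) = 1"
      using perms_132D(2)[OF that, of i] assms by (auto simp: mark_def)
  qed
  then show ?thesis by (simp add: shifted_sum_def descent_sum_def)
qed

lemma shifted_sum_above:
  assumes "s \<ge> int n"
  shows "shifted_sum x v p s n = v ^ n * descent_sum p n"
proof -
  have "diagonal_weight x v s n \<pi> = v ^ n" if pi: "\<pi> \<in> perms_132 n" for \<pi>
  proof -
    have "diagonal_weight x v s n \<pi> = (\<Prod>i\<in>{1..n}. v)"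
      unfolding diagonal_weight_def
    proof (rule prod.cong[OF refl])
      fix i assume "i \<in> {1..n}"
      then show "mark x v (int (\<pi> i) - int i + s) = v"
        using perms_132D(2)[OF pi, of i] assms by (auto simp: mark_def)
    qed
    then show ?thesis by simp
  qed
  then show ?thesis by (simp add: shifted_sum_def descent_sum_def sum_distrib_left)
qed

section \<open>Power series over Laurent series\<close>

definition laurent_monom :: "'a::comm_ring_1 \<Rightarrow> int \<Rightarrow> 'a fls" where
  "laurent_monom c k = fls_shift (- k) (fls_const c)"

lemma laurent_monom_nth: "laurent_monom c k $$ s = (if s = k then c else 0)"
  by (simp add: laurent_monom_def)

lemma laurent_monom_times_nth: "(laurent_monom c k * f) $$ s = c * f $$ (s - k)"
  by (simp add: laurent_monom_def fls_shifted_times_simps fls_mult_const_nth)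

lemma laurent_monom_mult: "laurent_monom c k * laurent_monom d l = laurent_monom (c * d) (k + l)"
  by (rule fls_eqI) (auto simp: laurent_monom_times_nth laurent_monom_nth)

text \<open>
  The substitution \<open>z := a * z * t ^ e\<close>, which is a ring homomorphism. The outer series variable
  is \<open>z\<close> and the inner Laurent variable is \<open>t\<close>. Negative powers of \<open>t\<close> are needed, since \<open>t\<close> records
  the shift of the diagonal.
\<close>

definition twist :: "'a \<Rightarrow> int \<Rightarrow> 'a fps \<Rightarrow> 'a::comm_ring_1 fls fps" where
  "twist a e f = Abs_fps (\<lambda>n. laurent_monom (a ^ n * f $ n) (e * int n))"

abbreviation lift :: "'a fps \<Rightarrow> 'a::comm_ring_1 fls fps" where
  "lift \<equiv> twist 1 0"

lemma twist_nth: "twist a e f $ n = laurent_monom (a ^ n * f $ n) (e * int n)"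
  by (simp add: twist_def)

lemma twist_nth_nth: "twist a e f $ n $$ s = (if s = e * int n then a ^ n * f $ n else 0)"
  by (simp add: twist_nth laurent_monom_nth)

lemma twist_times_nth_nth:
  "(twist a e f * g) $ n $$ s = (\<Sum>i=0..n. a ^ i * f $ i * g $ (n - i) $$ (s - e * int i))"
  by (simp add: fps_mult_nth twist_nth fls_nth_sum laurent_monom_times_nth)

lemma twist_mult: "twist a e (f * g) = twist a e f * twist a e g"
proof (intro fps_ext fls_eqI)
  fix n s
  have "(twist a e f * twist a e g) $ n $$ s
     = (\<Sum>i=0..n. if s = e * int n then a ^ n * (f $ i * g $ (n - i)) else 0)"
    unfolding twist_times_nth_nth
  proof (rule sum.cong[OF refl])
    fix i assume "i \<in> {0..n}"
    then obtain k where "n = i + k" by (auto simp: le_iff_add)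
    then show "a ^ i * f $ i * twist a e g $ (n - i) $$ (s - e * int i)
        = (if s = e * int n then a ^ n * (f $ i * g $ (n - i)) else 0)"
      by (auto simp: twist_nth_nth algebra_simps power_add)
  qed
  then show "twist a e (f * g) $ n $$ s = (twist a e f * twist a e g) $ n $$ s"
    by (simp add: twist_nth_nth fps_mult_nth sum_distrib_left)
qed

lemma twist_add: "twist a e (f + g) = twist a e f + twist a e g"
  and twist_diff: "twist a e (f - g) = twist a e f - twist a e g"
  by (intro fps_ext fls_eqI; simp add: twist_nth_nth algebra_simps)+

lemma twist_const: "twist a e (fps_const c) = fps_const (fls_const c)"
  by (intro fps_ext fls_eqI) (auto simp: twist_nth_nth)

lemma twist_1: "twist a e 1 = 1"
  using twist_const[of a e 1] by simp

lemma twist_X: "twist a e fps_X = fps_const (laurent_monom a e) * fps_X"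
  by (intro fps_ext fls_eqI) (auto simp: twist_nth_nth laurent_monom_nth le_Suc_eq)

lemma lift_X: "lift fps_X = fps_X"
  by (intro fps_ext fls_eqI) (auto simp: twist_nth_nth)

text \<open>
  The operator \<open>\<Omega>\<close>: it weights \<open>t ^ s\<close> like an entry at height \<open>s\<close>.
\<close>

definition mark_op :: "'a \<Rightarrow> 'a \<Rightarrow> 'a fls fps \<Rightarrow> 'a::comm_ring_1 fls fps" where
  "mark_op x v f = Abs_fps (\<lambda>n. Abs_fls (\<lambda>s. mark x v s * f $ n $$ s))"

lemma mark_op_nth_nth: "mark_op x v f $ n $$ s = mark x v s * f $ n $$ s"
  unfolding mark_op_def fps_nth_Abs_fps
  by (rule nth_Abs_fls_lower_bound[of "fls_subdegree (f $ n)"]) (simp add: fls_eq0_below_subdegree)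

lemma mark_op_add: "mark_op x v (f + g) = mark_op x v f + mark_op x v g"
  and mark_op_diff: "mark_op x v (f - g) = mark_op x v f - mark_op x v g"
  by (intro fps_ext fls_eqI; simp add: mark_op_nth_nth algebra_simps)+

lemma mark_op_const: "mark_op x v (fps_const (fls_const c)) = fps_const (fls_const (x * c))"
  by (intro fps_ext fls_eqI) (simp add: mark_op_nth_nth mark_def)

section \<open>Series supported on one side of the diagonal\<close>

text \<open>
  With \<open>e = 1\<close> the exponents of \<open>t\<close> are bounded below, and with \<open>e = - 1\<close> they are bounded above,
  uniformly in the exponent of \<open>z\<close>. Treating both directions at once saves every closure property
  from being proved twice.
\<close>

definition half_plane :: "int \<Rightarrow> int \<Rightarrow> 'a::comm_ring_1 fls fps \<Rightarrow> bool" where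
  "half_plane e d f \<longleftrightarrow> (\<forall>n s. e * s < d \<longrightarrow> f $ n $$ s = 0)"

lemma half_plane_fls_mult:
  fixes f g :: "'a::comm_ring_1 fls"
  assumes "\<And>s. e * s < d \<Longrightarrow> f $$ s = 0" "\<And>s. e * s < d' \<Longrightarrow> g $$ s = 0" "e * s < d + d'"
  shows "(f * g) $$ s = 0"
  unfolding fls_times_nth(2)
proof (rule sum.neutral, rule ballI)
  fix i
  show "f $$ i * g $$ (s - i) = 0"
  proof (cases "e * i < d")
    case False
    then have "e * (s - i) < d'" using assms(3) by (simp add: algebra_simps)
    then show ?thesis using assms(2) by simp
  qed (use assms(1) in simp)
qed

lemma half_plane_mult:
  assumes "half_plane e d f" "half_plane e d' g"
  shows "half_plane e (d + d') (f * g)"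
  unfolding half_plane_def fps_mult_nth fls_nth_sum
proof (intro allI impI sum.neutral ballI)
  fix n s i assume "e * s < d + d'"
  with assms show "(f $ i * g $ (n - i)) $$ s = 0"
    by (intro half_plane_fls_mult[of e d _ d']) (auto simp: half_plane_def)
qed

lemma half_plane_diff: "half_plane e d f \<Longrightarrow> half_plane e d g \<Longrightarrow> half_plane e d (f - g)"
  by (auto simp: half_plane_def)

lemma half_plane_lift: "half_plane e 0 (lift f)"
  by (auto simp: half_plane_def twist_nth_nth)

lemma half_plane_twist: "half_plane e 0 (twist a e f)"
  by (auto simp: half_plane_def twist_nth_nth mult_less_0_iff zero_less_mult_iff)

lemma half_plane_twist_strict:
  assumes "f $ 0 = 0" "e \<noteq> 0"
  shows "half_plane e 1 (twist a e f)"
  unfolding half_plane_def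
proof (intro allI impI)
  fix n s assume less: "e * s < 1"
  have "n = 0" if "s = e * int n"
  proof -
    have "(e * e) * int n \<le> 0" using less that by (simp add: mult.assoc)
    moreover have "e * e > 0" using assms(2) by (simp add: zero_less_mult_iff) linarith
    ultimately show ?thesis
      using mult_pos_pos[of "e * e" "int n"] by (metis gr0I leD of_nat_0_less_iff)
  qed
  then show "twist a e f $ n $$ s = 0" using assms by (auto simp: twist_nth_nth)
qed

text \<open>
  The recursion for the coefficients of an inverse series only forms products and sums.
\<close>

lemma half_plane_inverse:
  fixes f :: "'a::field fls fps"
  assumes f: "half_plane e 0 f" and f0: "f $ 0 = 1"
  shows "half_plane e 0 (inverse f)"
proof -
  let ?g = "inverse f"
  have fg: "f * ?g = 1" using f0 by (simp add: inverse_mult_eq_1')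
  have "\<forall>s. e * s < 0 \<longrightarrow> ?g $ n $$ s = 0" for n
  proof (induction n rule: less_induct)
    case (less n)
    have "(f * ?g) $ n = f $ 0 * ?g $ n + (\<Sum>i=1..n. f $ i * ?g $ (n - i))"
      unfolding fps_mult_nth by (simp add: sum.atLeast_Suc_atMost)
    then have *: "?g $ n = (if n = 0 then 1 else 0) - (\<Sum>i=1..n. f $ i * ?g $ (n - i))"
      using fg f0 by simp
    show ?case
    proof (intro allI impI)
      fix s :: int assume s: "e * s < 0"
      have "(f $ i * ?g $ (n - i)) $$ s = 0" if "i \<in> {1..n}" for i
        using f less[of "n - i"] s that
        by (intro half_plane_fls_mult[of e 0 _ 0]) (auto simp: half_plane_def)
      moreover have "s \<noteq> 0" using s by auto
      ultimately show "?g $ n $$ s = 0" by (subst *) (auto simp: fls_nth_sum)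
    qed
  qed
  then show ?thesis by (simp add: half_plane_def)
qed

lemma mark_op_lift: "mark_op x v (lift f) = fps_const (fls_const x) * lift f"
  by (intro fps_ext fls_eqI) (auto simp: mark_op_nth_nth twist_nth_nth mark_def fls_mult_const_nth)

lemma mark_op_right: "half_plane 1 1 f \<Longrightarrow> mark_op x v f = fps_const (fls_const v) * f"
  by (intro fps_ext fls_eqI) (auto simp: mark_op_nth_nth half_plane_def mark_def fls_mult_const_nth)

lemma mark_op_left: "half_plane (-1) 1 f \<Longrightarrow> mark_op x v f = f"
  by (intro fps_ext fls_eqI) (auto simp: mark_op_nth_nth half_plane_def mark_def)

lemma half_plane_nth_0: "half_plane e 1 f \<Longrightarrow> f $ n $$ 0 = 0"
  by (simp add: half_plane_def)

section \<open>The kernel equation\<close>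

definition descent_series :: "'a::comm_ring_1 \<Rightarrow> 'a fps" where
  "descent_series p = Abs_fps (descent_sum p)"

text \<open>
  The generating function, by size, of the blocks \<open>\<sigma> n\<close> counted by descents; the correction
  \<open>p - 1\<close> is that of an empty \<open>\<sigma>\<close>. A \<open>132\<close>-avoiding permutation is a sequence of such blocks, each
  one above and to the left of the next.
\<close>

definition component_series :: "'a::comm_ring_1 \<Rightarrow> 'a fps" where
  "component_series p = fps_X * (descent_series p + fps_const (p - 1))"

lemma component_series_Suc:
  "component_series p $ Suc j = descent_sum p j + (if j = 0 then p - 1 else 0)"
  by (simp add: component_series_def descent_series_def)

lemma component_series_0: "component_series p $ 0 = 0"
  by (simp add: component_series_def)

text \<open>
  The recursion for shifted sums, with the diagonal so far away that it stays outside both parts.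
\<close>

lemma descent_series_eq: "descent_series p = 1 + component_series p * descent_series p"
proof (rule fps_ext)
  fix n show "descent_series p $ n = (1 + component_series p * descent_series p) $ n"
  proof (cases n)
    case 0
    then show ?thesis
      by (simp add: descent_series_def descent_sum_def perms_132_0 run_weight_def component_series_0)
  next
    case (Suc N)
    \<comment> \<open>With shift \<open>- n\<close> every entry has weight \<open>1\<close>, so \<open>x\<close> and \<open>v\<close> may be chosen freely.\<close>
    have "descent_sum p (Suc N) = shifted_sum 1 1 p (- int (Suc N)) (Suc N)"
      by (simp add: shifted_sum_below)
    also have "\<dots> = (\<Sum>j\<le>N. component_series p $ Suc j * descent_sum p (N - j))"
      unfolding shifted_sum_Suc
    proof (rule sum.cong[OF refl])
      fix j assume "j \<in> {..N}"
      then show "mark 1 1 (int (N - j) + - int (Suc N)) *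
         (shifted_sum 1 1 p (- int (Suc N) + int (N - j)) j + (if j = 0 then p - 1 else 0)) *
         shifted_sum 1 1 p (- int (Suc N) - int j - 1) (N - j) =
         component_series p $ Suc j * descent_sum p (N - j)"
        unfolding component_series_Suc by (simp add: mark_def shifted_sum_below)
    qed
    also have "\<dots> = (component_series p * descent_series p) $ Suc N"
      unfolding fps_mult_nth sum.atLeast0_atMost_Suc_shift
      by (simp add: component_series_0 descent_series_def atLeast0AtMost)
    finally show ?thesis using Suc by (simp add: descent_series_def)
  qed
qed

text \<open>
  The cutoff \<open>\<bar>s\<bar> \<le> n\<close> keeps the exponents of \<open>t\<close> bounded for fixed \<open>n\<close>. What it omits is known
  from \<open>shifted_sum_below\<close> and \<open>shifted_sum_above\<close>.
\<close>

definition shifted_series :: "'a \<Rightarrow> 'a \<Rightarrow> 'a \<Rightarrow> 'a::comm_ring_1 fls fps" where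
  "shifted_series x v p =
     Abs_fps (\<lambda>n. Abs_fls (\<lambda>s. if \<bar>s\<bar> \<le> int n then shifted_sum x v p s n else 0))"

lemma shifted_series_nth_nth:
  "shifted_series x v p $ n $$ s = (if \<bar>s\<bar> \<le> int n then shifted_sum x v p s n else 0)"
  unfolding shifted_series_def fps_nth_Abs_fps
  by (rule nth_Abs_fls_lower_bound[of "- int n"]) auto

text \<open>
  One term of the recursion, in the form in which it enters the equation for the series. Let
  \<open>c = j + 1\<close> be the size of the first block \<open>\<sigma> n\<close>. If \<open>2 * c \<le> n + s\<close>, the block lies entirely above
  the shifted diagonal and contributes \<open>v ^ c\<close>. Otherwise the rest of the permutation lies below the
  shifted diagonal. In this case the block is below it as well when \<open>s = - n\<close>, and for \<open>s > - n\<close>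
  the diagonal passes through the block. For \<open>\<bar>s\<bar> > n\<close> every summand vanishes by the cutoff.
\<close>

lemma first_component_cases:
  assumes n: "n = m + j + 1"
  shows "(if \<bar>s\<bar> \<le> int n then
      mark x v (int m + s) * (shifted_sum x v p (s + int m) j + (if j = 0 then p - 1 else 0))
        * shifted_sum x v p (s - int j - 1) m else 0) =
    v ^ Suc j * component_series p $ Suc j * shifted_series x v p $ m $$ (s - int (Suc j))
    + descent_sum p m * ((if s = - int n then component_series p $ Suc j else 0)
       + mark x v (s + int m) * (shifted_series x v p $ j $$ (s + int m)
           + (if j = 0 \<and> s + int m = 0 then p - 1 else 0)))"
proof -
  consider "\<not> \<bar>s\<bar> \<le> int n" | "\<bar>s\<bar> \<le> int n" "2 * int (Suc j) \<le> int n + s"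
    | "s = - int n" | "s > - int n" "int n + s < 2 * int (Suc j)" "\<bar>s\<bar> \<le> int n"
    by linarith
  then show ?thesis
  proof cases
    case 1
    then show ?thesis using n by (auto simp: shifted_series_nth_nth)
  next
    case 2
    then have "shifted_sum x v p (s + int m) j = v ^ j * descent_sum p j"
      using n by (intro shifted_sum_above) simp
    with 2 n show ?thesis
      by (auto simp: shifted_series_nth_nth component_series_Suc mark_def algebra_simps)
  next
    case 3
    then have "shifted_sum x v p (s + int m) j = descent_sum p j"
      "shifted_sum x v p (s - int j - 1) m = descent_sum p m"
      using n by (auto intro!: shifted_sum_below)
    with 3 n show ?thesis
      by (auto simp: shifted_series_nth_nth component_series_Suc mark_def algebra_simps)
  next
    case 4
    then have "shifted_sum x v p (s - int j - 1) m = descent_sum p m"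
      using n by (intro shifted_sum_below) simp
    with 4 n show ?thesis
      by (auto simp: shifted_series_nth_nth algebra_simps)
  qed
qed

text \<open>
  The summand with \<open>twist v 1 D * H\<close> accounts for first blocks above the diagonal. The other
  summand accounts for a first block not above the diagonal, followed by an arbitrary permutation
  below the diagonal: the term \<open>twist 1 (-1) D\<close> for a block missed by the diagonal, the term
  with \<open>mark_op\<close> for a block met by it.
\<close>

lemma shifted_series_eq:
  fixes x v p :: "'a::comm_ring_1"
  defines "H \<equiv> shifted_series x v p" and "D \<equiv> component_series p"
  shows "H = 1 + twist v 1 D * H + twist 1 (-1) (descent_series p)
     * (twist 1 (-1) D + fps_X * mark_op x v (H + fps_const (fls_const (p - 1))))"
  (is "_ = 1 + ?A + _ * ?Q")
proof (intro fps_ext fls_eqI)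
  fix n s
  show "H $ n $$ s = (1 + ?A + twist 1 (-1) (descent_series p) * ?Q) $ n $$ s"
  proof (cases n)
    case 0
    then show ?thesis
      by (auto simp: H_def D_def shifted_series_nth_nth shifted_sum_0 component_series_0 twist_nth laurent_monom_def)
  next
    case (Suc N)
    have "?A $ n $$ s = (\<Sum>j\<le>N. v ^ Suc j * D $ Suc j * H $ (N - j) $$ (s - int (Suc j)))"
      unfolding Suc twist_times_nth_nth sum.atLeast0_atMost_Suc_shift
      by (simp add: D_def component_series_0 atLeast0AtMost)
    moreover have "(twist 1 (-1) (descent_series p) * ?Q) $ n $$ s
      = (\<Sum>m\<le>N. descent_sum p m * ?Q $ Suc (N - m) $$ (s + int m))"
      unfolding Suc twist_times_nth_nth sum.atLeast0_atMost_Suc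
      by (simp add: D_def component_series_0 twist_nth laurent_monom_def descent_series_def atLeast0AtMost
          Suc_diff_le del: fps_X_mult_nth)
    moreover have "\<dots> = (\<Sum>j\<le>N. descent_sum p (N - j) * ?Q $ Suc j $$ (s + int (N - j)))"
      by (rule sum.reindex_bij_witness[of _ "\<lambda>j. N - j" "\<lambda>j. N - j"]) auto
    ultimately have "(1 + ?A + twist 1 (-1) (descent_series p) * ?Q) $ n $$ s
       = (\<Sum>j\<le>N. v ^ Suc j * D $ Suc j * H $ (N - j) $$ (s - int (Suc j))
           + descent_sum p (N - j) * ?Q $ Suc j $$ (s + int (N - j)))"
      using Suc by (simp add: sum.distrib)
    also have "\<dots> = (\<Sum>j\<le>N. if \<bar>s\<bar> \<le> int n then
      mark x v (int (N - j) + s) * (shifted_sum x v p (s + int (N - j)) j + (if j = 0 then p - 1 else 0))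
        * shifted_sum x v p (s - int j - 1) (N - j) else 0)"
    proof (rule sum.cong[OF refl])
      fix j assume j: "j \<in> {..N}"
      then have n: "n = (N - j) + j + 1" using Suc by simp
      have "?Q $ Suc j $$ (s + int (N - j)) = (if s = - int n then D $ Suc j else 0)
       + mark x v (s + int (N - j)) * (H $ j $$ (s + int (N - j))
           + (if j = 0 \<and> s + int (N - j) = 0 then p - 1 else 0))"
        using j Suc by (auto simp: twist_nth_nth mark_op_nth_nth of_nat_diff)
      with first_component_cases[OF n, of s x v p]
      show "v ^ Suc j * D $ Suc j * H $ (N - j) $$ (s - int (Suc j))
           + descent_sum p (N - j) * ?Q $ Suc j $$ (s + int (N - j)) =
        (if \<bar>s\<bar> \<le> int n then
      mark x v (int (N - j) + s) * (shifted_sum x v p (s + int (N - j)) j + (if j = 0 then p - 1 else 0))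
        * shifted_sum x v p (s - int j - 1) (N - j) else 0)"
        unfolding H_def D_def by presburger
    qed
    also have "\<dots> = H $ n $$ s"
      unfolding H_def shifted_series_nth_nth by (simp add: Suc shifted_sum_Suc)
    finally show ?thesis ..
  qed
qed

text \<open>
  Multiplication by \<open>1 - D\<close>, twisted in both ways, clears the geometric series in the previous
  equation, since \<open>1 - D\<close> is the reciprocal of the descent series.
\<close>

lemma kernel_equation:
  fixes x v p :: "'a::comm_ring_1"
  defines "H \<equiv> shifted_series x v p"
    and "U \<equiv> twist v 1 (1 - component_series p)" and "W \<equiv> twist 1 (-1) (1 - component_series p)"
  shows "U * W * H = 1 + fps_const (fls_const (x * (p - 1))) * fps_X + fps_X * mark_op x v H"
proof -
  let ?D = "component_series p" and ?N = "twist 1 (-1) (descent_series p)"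
  have "(1 - ?D) * descent_series p = 1"
    using descent_series_eq[of p] by (simp add: algebra_simps)
  then have WN: "W * ?N = 1"
    unfolding W_def by (metis twist_mult twist_1)
  let ?E = "1 - W + fps_X * mark_op x v (H + fps_const (fls_const (p - 1)))"
  have UH: "U * H = 1 + ?N * ?E"
    using shifted_series_eq[of x v p]
    by (simp add: H_def U_def W_def twist_diff twist_1 algebra_simps)
  have "U * W * H = W * (U * H)" by (simp only: mult_ac)
  also have "\<dots> = W + (W * ?N) * ?E"
    unfolding UH by (simp only: distrib_left mult.assoc mult_1_right)
  also have "\<dots> = 1 + fps_const (fls_const (x * (p - 1))) * fps_X + fps_X * mark_op x v H"
    unfolding WN by (simp add: mark_op_add mark_op_const algebra_simps)
  finally show ?thesis .
qed

lemma component_curve: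
  fixes p :: "'a::comm_ring_1"
  defines "M \<equiv> 1 - component_series p"
  shows "fps_X * (1 + fps_const (p - 1) * M) = M * (1 - M)"
proof -
  have MN: "M * descent_series p = 1"
    using descent_series_eq[of p] by (simp add: M_def algebra_simps)
  have "M * (1 - M) = fps_X * (M * descent_series p + fps_const (p - 1) * M)"
    by (simp add: M_def) (simp add: component_series_def algebra_simps)
  then show ?thesis unfolding MN ..
qed

text \<open>
  The product of two twists of \<open>component_curve\<close>. Because \<open>(v * z * t) * (z / t) = v * z\<^sup>2\<close>, the
  variable \<open>t\<close> cancels from the coefficients.
\<close>

lemma twisted_curve:
  fixes p v :: "'a::comm_ring_1"
  defines "U \<equiv> twist v 1 (1 - component_series p)" and "W \<equiv> twist 1 (-1) (1 - component_series p)"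
    and "q \<equiv> fps_const (fls_const (p - 1))"
  shows "fps_const (fls_const v) * fps_X ^ 2 * (1 + q * U) * (1 + q * W) = U * W * (1 - U) * (1 - W)"
proof -
  have *: "fps_const (laurent_monom a e) * fps_X * (1 + q * twist a e (1 - component_series p))
      = twist a e (1 - component_series p) * (1 - twist a e (1 - component_series p))" for a e
    using arg_cong[OF component_curve[of p], of "twist a e"]
    by (simp only: twist_mult twist_diff twist_add twist_1 twist_const twist_X q_def)
  have V: "fps_const (laurent_monom v 1) * fps_const (laurent_monom 1 (-1)) = fps_const (fls_const v)"
    by (simp add: laurent_monom_mult) (simp add: laurent_monom_def)
  have "fps_const (fls_const v) * fps_X ^ 2 * (1 + q * U) * (1 + q * W)
    = (fps_const (laurent_monom v 1) * fps_X * (1 + q * U)) * (fps_const (laurent_monom 1 (-1)) * fps_X * (1 + q * W))"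
    unfolding V[symmetric] by (simp only: power2_eq_square mult_ac)
  also have "\<dots> = (U * (1 - U)) * (W * (1 - W))"
    using *[of v 1] *[of 1 "-1"] by (simp only: U_def W_def)
  finally show ?thesis by (simp only: mult_ac)
qed

section \<open>Solution of the kernel equation\<close>

text \<open>
  The left-hand side is the kernel equation after insertion of the proposed solution and clearing
  of denominators. It is a polynomial of degree two in each of \<open>U\<close> and \<open>W\<close>. Its coefficients agree with
  those of the difference of the two sides of the last assumption: at \<open>1\<close>, \<open>U\<close>, \<open>W\<close> and
  \<open>U * W\<close> by the first four assumptions, in turn, and at the other monomials identically.
\<close>

lemma kernel_identity:
  fixes U W u w R z v q :: "'b::comm_ring_1"
  assumes "R * u * w = z * v * w + z * u - v * z^2"
    and "R * w = z * v * w + z + v * z^2 * q"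
    and "R * u = z * v + z * u + v * z^2 * q"
    and "u + w - u * w = z * v + z - v * z^2 * q^2 + 1 - R"
    and "v * z^2 * (1 + q * U) * (1 + q * W) = U * W * (1 - U) * (1 - W)"
  shows "(1 - U) * (U * W - z * v) * (W - w) + (1 - W) * (U * W - z) * (U - u)
     + (U * W - R) * (U - u) * (W - w) = 0"
proof -
  have "(1 - U) * (U * W - z * v) * (W - w) + (1 - W) * (U * W - z) * (U - u)
     + (U * W - R) * (U - u) * (W - w)
     = (v * z^2 * (1 + q * U) * (1 + q * W) - U * W * (1 - U) * (1 - W))
       - (R * u * w - (z * v * w + z * u - v * z^2))
       + (R * w - (z * v * w + z + v * z^2 * q)) * U
       + (R * u - (z * v + z * u + v * z^2 * q)) * W
       - ((u + w - u * w) - (z * v + z - v * z^2 * q^2 + 1 - R)) * U * W"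
    by (simp add: algebra_simps power2_eq_square)
  then show ?thesis using assms by simp
qed

text \<open>
  The equations for \<open>u\<close> and \<open>w\<close> come from the coefficients at \<open>W\<close> and \<open>U\<close>. The quadratic equation
  for \<open>R\<close> is the condition under which the coefficients at \<open>1\<close> and \<open>U * W\<close> agree as well. Both are
  consequences of it after multiplication by \<open>(R - z) * (R - z * v)\<close>.
\<close>

lemma pole_relations:
  fixes R z v q u w :: "'b::idom"
  assumes quad: "(R - 1) * (R - (1 + v) * z) + v * z^2 * (q^2 * R + 1 + 2 * q) = 0"
    and u: "u * (R - z) = z * v * (1 + z * q)" and w: "w * (R - z * v) = z * (1 + v * z * q)"
    and nz: "R - z \<noteq> 0" "R - z * v \<noteq> 0"
  shows "R * u * w = z * v * w + z * u - v * z^2"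
    and "u + w - u * w = z * v + z - v * z^2 * q^2 + 1 - R"
proof -
  let ?c = "(R - z) * (R - z * v)"
  have c: "?c \<noteq> 0" using nz by simp
  have "?c * (R * u * w - (z * v * w + z * u - v * z^2)) =
     R * (u * (R - z)) * (w * (R - z * v)) - z * v * (w * (R - z * v)) * (R - z)
     - z * (u * (R - z)) * (R - z * v) + v * z^2 * ?c"
    by (simp add: algebra_simps)
  also have "\<dots> = v * z^2 * ((R - 1) * (R - (1 + v) * z) + v * z^2 * (q^2 * R + 1 + 2 * q))"
    unfolding u w by (simp add: algebra_simps power2_eq_square)
  finally show "R * u * w = z * v * w + z * u - v * z^2" using quad c by simp
  have "?c * ((u + w - u * w) - (z * v + z - v * z^2 * q^2 + 1 - R)) =
     (u * (R - z)) * (R - z * v) + (w * (R - z * v)) * (R - z) - (u * (R - z)) * (w * (R - z * v))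
     - ?c * (z * v + z - v * z^2 * q^2 + 1 - R)"
    by (simp add: algebra_simps)
  also have "\<dots> = ((R - 1) * (R - (1 + v) * z) + v * z^2 * (q^2 * R + 1 + 2 * q)) * (R - z - z * v)"
    unfolding u w by (simp add: algebra_simps power2_eq_square)
  finally show "u + w - u * w = z * v + z - v * z^2 * q^2 + 1 - R" using quad c by simp
qed

text \<open>
  The factor \<open>z\<close> lets the lowest nonzero coefficient of \<open>d\<close> be expressed by even lower ones.
\<close>

lemma fixed_point_zero:
  fixes d :: "'a::comm_ring_1 fls fps"
  assumes "d = fps_X * (g * mark_op x v d)"
  shows "d = 0"
proof (rule fps_ext)
  fix n show "d $ n = 0 $ n"
  proof (induction n rule: less_induct)
    case (less n)
    show ?case
    proof (cases n)
      case 0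
      then show ?thesis by (subst assms) simp
    next
      case (Suc k)
      have "mark_op x v d $ i = 0" if "i \<le> k" for i
        by (rule fls_eqI) (use less[of i] that Suc in \<open>simp add: mark_op_nth_nth\<close>)
      then have "(g * mark_op x v d) $ k = 0" by (simp add: fps_mult_nth)
      then show ?thesis using Suc by (subst assms) simp
    qed
  qed
qed

lemma kernel_solution_unique:
  fixes f g h :: "'a::field fls fps"
  assumes "k * f = h + fps_X * mark_op x v f" "k * g = h + fps_X * mark_op x v g" "k $ 0 \<noteq> 0"
  shows "f = g"
proof -
  have "k * (f - g) = fps_X * mark_op x v (f - g)"
    using assms(1,2) by (simp add: mark_op_diff algebra_simps)
  then have "inverse k * k * (f - g) = fps_X * (inverse k * mark_op x v (f - g))"
    by (simp add: mult_ac)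
  then have "f - g = fps_X * (inverse k * mark_op x v (f - g))"
    using assms(3) by (simp add: inverse_mult_eq_1)
  then have "f - g = 0" by (rule fixed_point_zero)
  then show ?thesis by simp
qed

text \<open>
  The kernel equation is solved by the proposed \<open>F\<close>, because \<open>\<Omega>\<close> acts on the three parts of \<open>F\<close>
  as multiplication by \<open>v\<close>, \<open>x\<close> and \<open>1\<close>. By uniqueness \<open>F\<close> is the series of shifted sums, and its
  part free of \<open>t\<close> belongs to the shift \<open>0\<close>.
\<close>

lemma diagonal_series:
  fixes x v p :: "'a::field"
  defines "q \<equiv> fps_const (p - 1)"
  assumes quad: "(R - 1) * (R - (1 + fps_const v) * fps_X)
      + fps_const v * fps_X^2 * (q^2 * R + 1 + 2 * q) = 0"
    and R0: "R $ 0 = 1"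
  shows "Abs_fps (shifted_sum x v p 0) * (R - fps_const x * fps_X) = 1 + fps_const (x * (p - 1)) * fps_X"
proof -
  define z cv where "z = (fps_X :: 'a fps)" and "cv = fps_const v"
  define u where "u = z * cv * (1 + z * q) * inverse (R - z)"
  define w where "w = z * (1 + cv * z * q) * inverse (R - z * cv)"
  define \<kappa> where "\<kappa> = 1 + fps_const (x * (p - 1)) * z"
  define \<rho> where "\<rho> = \<kappa> * inverse (R - fps_const x * z)"
  have nz: "(R - z) $ 0 = 1" "(R - z * cv) $ 0 = 1" "(R - fps_const x * z) $ 0 = 1"
    using R0 by (simp_all add: z_def cv_def)
  have inv: "inverse (R - z) * (R - z) = 1" "inverse (R - z * cv) * (R - z * cv) = 1"
    "inverse (R - fps_const x * z) * (R - fps_const x * z) = 1"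
    using nz by (simp_all add: inverse_mult_eq_1)
  have u: "u * (R - z) = z * cv * (1 + z * q)" and w: "w * (R - z * cv) = z * (1 + cv * z * q)"
    and \<rho>: "\<rho> * (R - fps_const x * z) = \<kappa>"
    by (simp_all only: u_def w_def \<rho>_def mult.assoc inv mult_1_right)
  have "R - z \<noteq> 0" "R - z * cv \<noteq> 0"
    using nz by (metis fps_zero_nth zero_neq_one)+
  then have rel: "R * u * w = z * cv * w + z * u - cv * z^2"
      "u + w - u * w = z * cv + z - cv * z^2 * q^2 + 1 - R"
    using pole_relations[OF quad[folded z_def cv_def] u w] by blast+
  have rel': "R * w = z * cv * w + z + cv * z^2 * q" "R * u = z * cv + z * u + cv * z^2 * q"
    using u w by (simp_all add: algebra_simps power2_eq_square)
  have uw0: "u $ 0 = 0" "w $ 0 = 0" by (simp_all add: u_def w_def z_def)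

  define U W where "U = twist v 1 (1 - component_series p)" and "W = twist 1 (-1) (1 - component_series p)"
  define X V Q where "X = (fps_X :: 'a fls fps)" and "V = fps_const (fls_const v)"
    and "Q = fps_const (fls_const (p - 1))"
  \<comment> \<open>These quotients exist because the denominators have constant term \<open>1\<close> in \<open>z\<close>.\<close>
  define A where "A = (1 - U) * inverse (U - lift u)"
  define B where "B = (1 - W) * inverse (W - lift w)"
  define F where "F = lift \<rho> * (1 + A + B)"
  note hom = twist_mult twist_diff twist_add twist_1 twist_const twist_X
  have lift_z: "lift z = X" and lift_q: "lift q = Q" and lift_cv: "lift cv = V"
    by (simp_all add: z_def q_def cv_def X_def Q_def V_def lift_X twist_const)
  have U0: "U $ 0 = 1" "W $ 0 = 1" "(U - lift u) $ 0 = 1" "(W - lift w) $ 0 = 1"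
    by (simp_all add: U_def W_def twist_nth component_series_0 uw0 laurent_monom_def)
  have AU: "A * (U - lift u) = 1 - U" and BW: "B * (W - lift w) = 1 - W"
    using U0 by (simp_all add: A_def B_def mult.assoc inverse_mult_eq_1)
  have "half_plane 1 1 (1 - U)" "half_plane (-1) 1 (1 - W)"
    using half_plane_twist_strict[of "component_series p" 1 v]
      half_plane_twist_strict[of "component_series p" "-1" 1]
    by (simp_all add: U_def W_def twist_diff twist_1 component_series_0)
  moreover have "half_plane 1 0 (inverse (U - lift u))" "half_plane (-1) 0 (inverse (W - lift w))"
    by (rule half_plane_inverse[OF half_plane_diff[OF _ half_plane_lift] U0(3)]
        half_plane_inverse[OF half_plane_diff[OF _ half_plane_lift] U0(4)],
        simp add: U_def W_def half_plane_twist)+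
  ultimately have "half_plane 1 1 A" "half_plane (-1) 1 B"
    unfolding A_def B_def using half_plane_mult[where d = 1 and d' = 0] by fastforce+
  then have half: "half_plane 1 1 (lift \<rho> * A)" "half_plane (-1) 1 (lift \<rho> * B)"
    using half_plane_mult[OF half_plane_lift[of 1 \<rho>], of 1 A]
      half_plane_mult[OF half_plane_lift[of "-1" \<rho>], of 1 B]
    by simp_all
  have markF: "mark_op x v F = lift \<rho> * (fps_const (fls_const x) + V * A + B)"
    unfolding F_def distrib_left mult_1_right mark_op_add mark_op_lift
      mark_op_right[OF half(1)] mark_op_left[OF half(2)] V_def
    by (simp only: mult_ac)

  have "(1 - U) * (U * W - X * V) * (W - lift w) + (1 - W) * (U * W - X) * (U - lift u)
     + (U * W - lift R) * (U - lift u) * (W - lift w) = 0"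
  proof (rule kernel_identity[where q = Q])
    show "lift R * lift u * lift w = X * V * lift w + X * lift u - V * X^2"
      using arg_cong[OF rel(1), of lift]
      by (simp only: power2_eq_square hom lift_z lift_q lift_cv mult_ac)
    show "lift u + lift w - lift u * lift w = X * V + X - V * X^2 * Q^2 + 1 - lift R"
      using arg_cong[OF rel(2), of lift]
      by (simp only: power2_eq_square hom lift_z lift_q lift_cv mult_ac)
    show "lift R * lift w = X * V * lift w + X + V * X^2 * Q"
      using arg_cong[OF rel'(1), of lift]
      by (simp only: power2_eq_square hom lift_z lift_q lift_cv mult_ac)
    show "lift R * lift u = X * V + X * lift u + V * X^2 * Q"
      using arg_cong[OF rel'(2), of lift]
      by (simp only: power2_eq_square hom lift_z lift_q lift_cv mult_ac)
    show "V * X^2 * (1 + Q * U) * (1 + Q * W) = U * W * (1 - U) * (1 - W)"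
      unfolding U_def W_def V_def X_def Q_def by (rule twisted_curve)
  qed
  then have "(A * (U * W - X * V) + B * (U * W - X) + (U * W - lift R)) * ((U - lift u) * (W - lift w)) = 0"
    unfolding AU[symmetric] BW[symmetric] by (simp add: algebra_simps)
  moreover have "U - lift u \<noteq> 0" "W - lift w \<noteq> 0"
    using U0 by (metis fps_zero_nth zero_neq_one)+
  ultimately have "A * (U * W - X * V) + B * (U * W - X) + (U * W - lift R) = 0" by simp
  then have UW: "U * W * (1 + A + B) = lift R + X * (V * A + B)"
    by (simp add: algebra_simps)
  have "U * W * F = lift \<rho> * (U * W * (1 + A + B))"
    by (simp only: F_def mult_ac)
  also have "\<dots> = lift \<rho> * (lift R - fps_const (fls_const x) * X)
      + X * (lift \<rho> * (fps_const (fls_const x) + V * A + B))"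
    unfolding UW by (simp add: algebra_simps)
  also have "lift \<rho> * (lift R - fps_const (fls_const x) * X) = lift \<kappa>"
    using arg_cong[OF \<rho>, of lift] by (simp only: hom lift_z)
  also have "lift \<kappa> = 1 + fps_const (fls_const (x * (p - 1))) * X"
    by (simp only: \<kappa>_def hom lift_z)
  finally have F: "U * W * F = 1 + fps_const (fls_const (x * (p - 1))) * fps_X + fps_X * mark_op x v F"
    unfolding markF X_def .
  have "(U * W) $ 0 \<noteq> 0" using U0 by simp
  then have HF: "shifted_series x v p = F"
    using kernel_solution_unique[OF kernel_equation[where x = x and v = v and p = p, folded U_def W_def] F]
    by blast
  have "shifted_sum x v p 0 n = \<rho> $ n" for n
  proof -
    have "shifted_sum x v p 0 n = shifted_series x v p $ n $$ 0"
      by (simp add: shifted_series_nth_nth)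
    also have "\<dots> = \<rho> $ n"
      unfolding HF F_def distrib_left
      using half_plane_nth_0[OF half(1)] half_plane_nth_0[OF half(2)]
      by (simp add: twist_nth_nth)
    finally show ?thesis .
  qed
  then have "Abs_fps (shifted_sum x v p 0) = \<rho>" by (intro fps_ext) simp
  then show ?thesis using \<rho> by (simp add: \<kappa>_def z_def)
qed

section \<open>The closed form\<close>

lemma L_eq_shifted_sum: "L x v p = Abs_fps (shifted_sum x v p 0)"
proof (rule fps_ext)
  fix n show "L x v p $ n = Abs_fps (shifted_sum x v p 0) $ n"
    by (cases "n = 0")
       (simp_all add: L_def shifted_sum_0, simp add: shifted_sum_def diagonal_weight_0 run_weight_def)
qed

text \<open>
  The series under the square root is the discriminant of the quadratic equation, and \<open>R\<close> is its
  root with constant term \<open>1\<close>; the other root has constant term \<open>0\<close>.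
\<close>

lemma denominator_quadratic:
  fixes v p :: "'a::field_char_0"
  defines "q \<equiv> fps_const (p - 1)"
  defines "R \<equiv> fps_const (1/2) * (1 + (1 + fps_const v) * fps_X - fps_const v * q^2 * fps_X^2 + fps_sqrt1 (f\<^sub>1 v p))"
  shows "(R - 1) * (R - (1 + fps_const v) * fps_X) + fps_const v * fps_X^2 * (q^2 * R + 1 + 2 * q) = 0"
    and "R $ 0 = 1"
proof -
  let ?s = "fps_sqrt1 (f\<^sub>1 v p)" and ?z = "fps_X :: 'a fps"
  define c where "c = fps_const v"
  have s: "?s ^ 2 = f\<^sub>1 v p" "?s $ 0 = 1"
    using fps_sqrt1_unique[of "f\<^sub>1 v p" ?s] by (simp_all add: fps_nth_f\<^sub>1_0)
  show "R $ 0 = 1" using s(2) by (simp add: R_def q_def)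
  define b where "b = 1 + (1 + c) * ?z - c * q^2 * ?z^2"
  have "2 * fps_const (1/2) = (1 :: 'a fps)"
    by (simp add: numeral_fps_const)
  then have R: "2 * R = b + ?s"
    unfolding R_def b_def c_def by (simp only: mult.assoc[symmetric]) simp
  have f: "f\<^sub>1 v p = 1 - 2 * (1 + c) * ?z + ((1 - c)^2 - 2 * c * q * (q + 4)) * ?z^2
      - 2 * c * (1 + c) * q^2 * ?z^3 + c^2 * q^4 * ?z^4"
  proof -
    have "p + 3 = (p - 1) + 4" by simp
    then show ?thesis
      unfolding f\<^sub>1_def q_def c_def
      by (simp only: fps_const_add[symmetric] fps_const_sub[symmetric] fps_const_mult[symmetric]
          fps_const_power[symmetric] fps_const_1_eq_1 flip: numeral_fps_const)
  qed
  have "4 * ((R - 1) * (R - (1 + c) * ?z) + c * ?z^2 * (q^2 * R + 1 + 2 * q))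
    = (2 * R)^2 - 2 * b * (2 * R) + 4 * (1 + c) * ?z + 4 * c * ?z^2 * (1 + 2 * q)"
    by (simp add: b_def algebra_simps power2_eq_square)
  also have "\<dots> = ?s^2 - b^2 + 4 * (1 + c) * ?z + 4 * c * ?z^2 * (1 + 2 * q)"
    unfolding R by (simp add: algebra_simps power2_eq_square)
  also have "\<dots> = 0"
    unfolding s(1) unfolding f b_def by (simp add: algebra_simps power2_eq_square power3_eq_cube power4_eq_xxxx)
  finally have "4 * ((R - 1) * (R - (1 + c) * ?z) + c * ?z^2 * (q^2 * R + 1 + 2 * q)) = 0" .
  moreover have "(4 :: 'a fps) \<noteq> 0" by (simp add: numeral_fps_const)
  ultimately show "(R - 1) * (R - (1 + fps_const v) * ?z) + fps_const v * ?z^2 * (q^2 * R + 1 + 2 * q) = 0"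
    unfolding c_def[symmetric] by (simp only: mult_eq_0_iff) simp
qed

theorem theorem11:
  fixes x v p :: "'a::field_char_0"
  shows "L x v p =
    2 * (1 + fps_const (x * (p - 1)) * fps_X) /
    (1 + fps_const (1 + v - 2 * x) * fps_X - fps_const (v * (p - 1)^2) * fps_X^2
       + fps_sqrt1 (f\<^sub>1 v p))"
proof -
  define R where "R = fps_const (1/2) * (1 + (1 + fps_const v) * fps_X
    - fps_const v * (fps_const (p - 1))^2 * fps_X^2 + fps_sqrt1 (f\<^sub>1 v p))"
  let ?d = "1 + fps_const (1 + v - 2 * x) * fps_X - fps_const (v * (p - 1)^2) * fps_X^2 + fps_sqrt1 (f\<^sub>1 v p)"
  have L: "L x v p * (R - fps_const x * fps_X) = 1 + fps_const (x * (p - 1)) * fps_X"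
    unfolding L_eq_shifted_sum
    using denominator_quadratic[of v p] by (intro diagonal_series) (simp_all only: R_def)
  have "2 * fps_const (1/2) = (1 :: 'a fps)"
    by (simp add: numeral_fps_const)
  then have "2 * R = 1 + (1 + fps_const v) * fps_X
    - fps_const v * (fps_const (p - 1))^2 * fps_X^2 + fps_sqrt1 (f\<^sub>1 v p)"
    unfolding R_def by (simp only: mult.assoc[symmetric]) simp
  then have d: "?d = 2 * (R - fps_const x * fps_X)"
    by (simp only: fps_const_add[symmetric] fps_const_sub[symmetric] fps_const_mult[symmetric]
          fps_const_power[symmetric] fps_const_1_eq_1 flip: numeral_fps_const) (simp add: algebra_simps)
  have "(R - fps_const x * fps_X) $ 0 = 1"
    using denominator_quadratic(2)[of v p] by (simp add: R_def)
  then have "R - fps_const x * fps_X \<noteq> 0"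
    by (metis fps_zero_nth zero_neq_one)
  then have "?d \<noteq> 0" unfolding d by simp
  moreover have "L x v p * ?d = 2 * (1 + fps_const (x * (p - 1)) * fps_X)"
    unfolding d L[symmetric] by (simp only: mult_ac)
  ultimately show ?thesis by (metis nonzero_mult_div_cancel_right)
qed

end
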